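(* Let $X$ be a strong $R$-space and $A$ a nonempty closed subset of $X$. Then $A$, with the subspace topology, is a strong $R$-space.
   Context: For a $T_0$-space $X$: a subset is saturated if it equals the intersection of all open sets containing it; $Q(X)$ is the set of all nonempty compact saturated subsets of $X$ (compactness is the open-cover property). A $T_0$-space $X$ is a strong $R$-space if for every nonempty family $\{K_i: i\in I\}\subseteq Q(X)$ and every open $U\subseteq X$, $\bigcap_{i\in I}K_i\subseteq U$ implies $\bigcap_{i\in J}K_i\subseteq U$ for some nonempty finite $J\subseteq I$. *)

theory Defs
  imports "HOL-Analysis.Analysis"
begin

(* The conjunct S \<subseteq> topspace X is needed: for S not contained in the carrier
   no open set contains S, and the empty intersection is UNIV. *)
definition saturatedin :: "'a topology \<Rightarrow> 'a set \<Rightarrow> bool" where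
  "saturatedin X S \<longleftrightarrow> S \<subseteq> topspace X \<and> S = \<Inter>{U. openin X U \<and> S \<subseteq> U}"

definition compact_saturated_sets :: "'a topology \<Rightarrow> 'a set set" where
  "compact_saturated_sets X = {K. K \<noteq> {} \<and> compactin X K \<and> saturatedin X K}"

(* HOL cannot quantify over index types inside a definition, so families are taken as
   sets of sets; strong_R_space_indexed below recovers arbitrary indexed families. *)
definition strong_R_space :: "'a topology \<Rightarrow> bool" where
  "strong_R_space X \<longleftrightarrow> t0_space X \<and>
     (\<forall>\<K> U. \<K> \<noteq> {} \<and> \<K> \<subseteq> compact_saturated_sets X \<and> openin X U \<and> \<Inter>\<K> \<subseteq> U
        \<longrightarrow> (\<exists>\<F>. finite \<F> \<and> \<F> \<noteq> {} \<and> \<F> \<subseteq> \<K> \<and> \<Inter>\<F> \<subseteq> U))"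

lemma strong_R_space_indexed:
  fixes K :: "'i \<Rightarrow> 'a set"
  assumes "strong_R_space X" "I \<noteq> {}" "\<And>i. i \<in> I \<Longrightarrow> K i \<in> compact_saturated_sets X"
    and "openin X U" "(\<Inter>i\<in>I. K i) \<subseteq> U"
  obtains J where "finite J" "J \<noteq> {}" "J \<subseteq> I" "(\<Inter>i\<in>J. K i) \<subseteq> U"
proof -
  have "K ` I \<noteq> {}" "K ` I \<subseteq> compact_saturated_sets X" using assms(2,3) by auto
  then obtain \<F> where F: "finite \<F>" "\<F> \<noteq> {}" "\<F> \<subseteq> K ` I" "\<Inter>\<F> \<subseteq> U"
    using assms(1,4,5) unfolding strong_R_space_def by meson
  then obtain J where "J \<subseteq> I" "finite J" "\<F> = K ` J"
    by (meson finite_subset_image)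
  with F that show thesis by blast
qed

end

(* A compact saturated subset K of the closed subspace A has a saturation in X which is
   compact and meets A exactly in K. A family of such K whose intersection lies in
   A \<inter> W, with W open in X, therefore has saturations whose intersection lies in the open set
   W \<union> (X - A); a finite subfamily obtained in X for the latter works in A. *)
theory Submission
  imports Defs
begin

definition saturation_of :: "'a topology \<Rightarrow> 'a set \<Rightarrow> 'a set" where
  "saturation_of X S = \<Inter>{U. openin X U \<and> S \<subseteq> U}"

lemma saturation_of_minimal: "openin X U \<Longrightarrow> S \<subseteq> U \<Longrightarrow> saturation_of X S \<subseteq> U"
  unfolding saturation_of_def by blast

lemma subset_saturation_of: "S \<subseteq> saturation_of X S"
  unfolding saturation_of_def by blast

lemma saturation_of_subset_iff: "openin X U \<Longrightarrow> saturation_of X S \<subseteq> U \<longleftrightarrow> S \<subseteq> U"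
  using saturation_of_minimal[of X U S] subset_saturation_of[of S X] by blast

text \<open>\<open>S\<close> and its saturation have the same open supersets, hence the same
  intersection of these. The hypothesis makes the carrier one of them, which keeps the saturation
  inside the space.\<close>

lemma saturatedin_saturation_of:
  assumes "S \<subseteq> topspace X"
  shows "saturatedin X (saturation_of X S)"
proof -
  have "{U. openin X U \<and> saturation_of X S \<subseteq> U} = {U. openin X U \<and> S \<subseteq> U}"
    using saturation_of_subset_iff by blast
  then show ?thesis
    using saturation_of_minimal[OF openin_topspace assms]
    unfolding saturatedin_def by (simp add: saturation_of_def)
qed

text \<open>A cover of the saturation also covers \<open>S\<close>. A finite subcover of
  \<open>S\<close> has an open union, and every open set around \<open>S\<close> already contains
  the saturation.\<close>

lemma compactin_saturation_of:
  assumes "compactin X S"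
  shows "compactin X (saturation_of X S)"
  unfolding compactin_def
proof (intro conjI allI impI)
  show "saturation_of X S \<subseteq> topspace X"
    by (rule saturation_of_minimal[OF openin_topspace compactin_subset_topspace[OF assms]])
next
  fix \<U> assume \<U>: "Ball \<U> (openin X) \<and> saturation_of X S \<subseteq> \<Union>\<U>"
  then have "S \<subseteq> \<Union>\<U>" using subset_saturation_of[of S X] by blast
  then obtain \<F> where \<F>: "finite \<F>" "\<F> \<subseteq> \<U>" "S \<subseteq> \<Union>\<F>"
    using assms \<U> unfolding compactin_def by meson
  moreover from \<U> \<F>(2) have "openin X (\<Union>\<F>)" by (intro openin_Union) auto
  ultimately have "saturation_of X S \<subseteq> \<Union>\<F>"
    by (simp add: saturation_of_minimal)
  with \<F> show "\<exists>\<F>. finite \<F> \<and> \<F> \<subseteq> \<U> \<and> saturation_of X S \<subseteq> \<Union>\<F>"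
    by blast
qed

text \<open>Open sets of the subspace are traces \<open>T \<inter> A\<close>. If such a trace
  contains \<open>K\<close>, then \<open>T\<close> contains the saturation of \<open>K\<close> in
  \<open>X\<close>, so the part of the saturation in \<open>A\<close> lies in every relatively open
  superset of \<open>K\<close>.\<close>

lemma saturation_of_Int_subspace:
  assumes "saturatedin (subtopology X A) K"
  shows "saturation_of X K \<inter> A = K"
proof
  have KA: "K \<subseteq> A" and K: "K = \<Inter>{U. openin (subtopology X A) U \<and> K \<subseteq> U}"
    using assms by (auto simp: saturatedin_def)
  show "K \<subseteq> saturation_of X K \<inter> A"
    using KA subset_saturation_of[of K X] by blast
  have "saturation_of X K \<inter> A \<subseteq> U" if U: "openin (subtopology X A) U" "K \<subseteq> U" for U
  proof -
    obtain T where "openin X T" "U = T \<inter> A"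
      using U(1) unfolding openin_subtopology by blast
    then show ?thesis using U(2) saturation_of_minimal[of X T K] by blast
  qed
  then have "saturation_of X K \<inter> A \<subseteq> \<Inter>{U. openin (subtopology X A) U \<and> K \<subseteq> U}"
    by (intro Inter_greatest) simp
  then show "saturation_of X K \<inter> A \<subseteq> K"
    by (rule subset_trans[OF _ equalityD2[OF K]])
qed

lemma saturation_of_compact_saturated_subspace:
  assumes "K \<in> compact_saturated_sets (subtopology X A)"
  shows "saturation_of X K \<in> compact_saturated_sets X"
proof -
  have "K \<noteq> {}" "compactin X K"
    using assms by (auto simp: compact_saturated_sets_def compactin_subtopology)
  then show ?thesis
    using subset_saturation_of[of K X] compactin_saturation_of[of X K]
      saturatedin_saturation_of[of K X] compactin_subset_topspace[of X K]
    unfolding compact_saturated_sets_def by auto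
qed

theorem proposition5p1:
  fixes X :: "'a topology" and A :: "'a set"
  assumes "strong_R_space X"
    and "closedin X A"
    and "A \<noteq> {}"
  shows "strong_R_space (subtopology X A)"
  unfolding strong_R_space_def
proof (intro conjI allI impI)
  show "t0_space (subtopology X A)"
    using assms(1) by (simp add: strong_R_space_def t0_space_subtopology)
next
  fix \<K> U
  assume H: "\<K> \<noteq> {} \<and> \<K> \<subseteq> compact_saturated_sets (subtopology X A) \<and>
    openin (subtopology X A) U \<and> \<Inter>\<K> \<subseteq> U"
  then obtain W where W: "openin X W" "U = W \<inter> A"
    unfolding openin_subtopology by blast
  have trace: "saturation_of X K \<inter> A = K" if "K \<in> \<K>" for K
    using H that saturation_of_Int_subspace by (auto simp: compact_saturated_sets_def)
  have sat: "saturation_of X K \<in> compact_saturated_sets X" if "K \<in> \<K>" for K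
    using H that saturation_of_compact_saturated_subspace by blast
  \<comment> \<open>Closedness of \<open>A\<close> enters here, through its open complement.\<close>
  have op: "openin X (W \<union> (topspace X - A))"
    using W(1) assms(2) by (simp add: openin_Un closedin_def)
  have sub: "(\<Inter>K\<in>\<K>. saturation_of X K) \<subseteq> W \<union> (topspace X - A)"
  proof
    fix x assume x: "x \<in> (\<Inter>K\<in>\<K>. saturation_of X K)"
    \<comment> \<open>As \<open>\<K>\<close> is nonempty, \<open>x\<close> lies in the saturation of
      some member, which is a subset of the carrier.\<close>
    with H sat have "x \<in> topspace X"
      by (fastforce simp: compact_saturated_sets_def saturatedin_def)
    moreover have "x \<in> W" if "x \<in> A"
    proof -
      have "x \<in> \<Inter>\<K>" using x that trace by blast
      then show ?thesis using H W(2) by blast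
    qed
    ultimately show "x \<in> W \<union> (topspace X - A)" by blast
  qed
  \<comment> \<open>The family of saturations is indexed by \<open>\<K>\<close> itself, so the
    finite index set obtained is directly a subfamily of \<open>\<K>\<close>.\<close>
  obtain \<F> where \<F>: "finite \<F>" "\<F> \<noteq> {}" "\<F> \<subseteq> \<K>"
    "(\<Inter>K\<in>\<F>. saturation_of X K) \<subseteq> W \<union> (topspace X - A)"
    by (rule strong_R_space_indexed[OF assms(1) conjunct1[OF H] _ op sub]) (auto intro: sat)
  \<comment> \<open>Each member of the nonempty \<open>\<F>\<close> lies in \<open>A\<close>; this
    rules out the summand \<open>topspace X - A\<close> below.\<close>
  have "\<Inter>\<F> \<subseteq> A" using \<F>(2,3) trace by blast
  moreover have "\<Inter>\<F> \<subseteq> (\<Inter>K\<in>\<F>. saturation_of X K)"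
    by (intro INT_greatest subset_trans[OF Inter_lower subset_saturation_of])
  then have "\<Inter>\<F> \<subseteq> W \<union> (topspace X - A)"
    using \<F>(4) by (rule subset_trans)
  ultimately have "\<Inter>\<F> \<subseteq> U"
    unfolding W(2) by blast
  with \<F>(1-3) show "\<exists>\<F>. finite \<F> \<and> \<F> \<noteq> {} \<and> \<F> \<subseteq> \<K> \<and> \<Inter>\<F> \<subseteq> U"
    by (intro exI[of _ \<F>] conjI)
qed

end
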